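(* Let $G$ be a graph on $n$ vertices and $A\in\mathcal{S}(G)$. Suppose $\beta\subseteq E(\overline{G})$ is an SSP liberation set of $A$ and $\mathbf{x}$ is a real vector indexed by $E(\overline{G})$ with $\operatorname{supp}(\mathbf{x})=\beta$ such that $\langle \mathbf{x},\operatorname{vec}_{E(\overline{G})}(X)\rangle=0$ for all $X\in\mathcal{R}(A)$. Then for every $\varepsilon>0$ there is a matrix $A'\in\mathcal{S}(G+\beta)$ such that $\operatorname{spec}(A')=\operatorname{spec}(A)$, $A'$ has the strong spectral property (SSP), $\|A'-A\|<\varepsilon$, the entries of $A'$ corresponding to the edges in $\beta$ have the same signs as the corresponding entries of $\mathbf{x}$, and the off-diagonal entries of $A'$ outside $\beta$ have the same signs (positive, negative, or zero) as the corresponding entries of $A$.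
   Context: All graphs are simple, finite and undirected. For a graph $G$ on $n$ vertices, $\mathcal{S}(G)$ is the set of $n\times n$ real symmetric matrices (indexed by $V(G)$) whose off-diagonal $i,j$-entry is nonzero if and only if $\{i,j\}$ is an edge of $G$; diagonal entries are arbitrary. $\overline{G}$ is the complement of $G$, and $G+\beta$ is the graph obtained from $G$ by adding the edges in $\beta$. $\operatorname{spec}(A)$ is the multiset of eigenvalues; $\|\cdot\|$ is any fixed matrix norm; $\operatorname{supp}(\mathbf{x})$ is the set of indices at which $\mathbf{x}$ is nonzero. A real symmetric matrix $A$ has the SSP if $X=O$ is the only real symmetric matrix with $A\circ X=O$, $I\circ X=O$ and $AX-XA=O$, where $\circ$ is the entrywise product. Let $\mathcal{S}^{\rm cl}_0(G)$ be the set of real symmetric matrices with zero diagonal whose off-diagonal $i,j$-entry is zero whenever $\{i,j\}$ is not an edge of $G$ (entries on edges are arbitrary, possibly zero). For a spanning supergraph $G'$ of $G$ (same vertex set, $E(G)\subseteq E(G')$), a matrix $A\in\mathcal{S}(G)$ has the SSP with respect to $G'$ if $X=O$ is the only matrix $X\in\mathcal{S}^{\rm cl}_0(\overline{G'})$ with $AX-XA=O$. A nonempty set $\beta\subseteq E(\overline{G})$ is an SSP liberation set of $A$ if and only if $A$ has the SSP with respect to $G+\beta'$ for every $\beta'\subset\beta$ with $|\beta'|=|\beta|-1$. $\mathcal{R}(A)$ is the set of all real symmetric matrices $X$ with $A\circ X=I\circ X=O$ and $AX-XA=O$. $\operatorname{vec}_{E(\overline{G})}(X)$ is the vector of the entries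 $X_{i,j}$ over $\{(i,j):\{i,j\}\in E(\overline{G}),\ i<j\}$, and $\langle\cdot,\cdot\rangle$ is the standard inner product. *)

theory Defs
  imports "HOL-Analysis.Analysis" "HOL-Computational_Algebra.Polynomial"
begin

text \<open>
  A simple graph on the finite vertex type \<open>'n\<close> is given by its edge set, a set of two-element
  sets of vertices. Thus spanning supergraphs are supersets, and \<open>G \<union> \<beta>\<close> is the graph \<open>G + \<beta>\<close>.
\<close>

definition simple_graph :: "'n::finite set set \<Rightarrow> bool" where
  "simple_graph G \<longleftrightarrow> (\<forall>e\<in>G. card e = 2)"

definition complement :: "'n::finite set set \<Rightarrow> 'n set set" where
  "complement G = {e. card e = 2} - G"

definition sym_matrix :: "real^'n^'n \<Rightarrow> bool" where
  "sym_matrix A \<longleftrightarrow> transpose A = A"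

definition hadamard :: "real^'n^'n \<Rightarrow> real^'n^'n \<Rightarrow> real^'n^'n" where
  "hadamard A B = (\<chi> i j. A $ i $ j * B $ i $ j)"

definition graph_matrices :: "'n::finite set set \<Rightarrow> (real^'n^'n) set" where
  "graph_matrices G =
     {A. sym_matrix A \<and> (\<forall>i j. i \<noteq> j \<longrightarrow> (A $ i $ j \<noteq> 0 \<longleftrightarrow> {i, j} \<in> G))}"

text \<open>The set \<open>S\<^sub>0\<^sup>c\<^sup>l(G)\<close>.\<close>

definition graph_matrices_cl0 :: "'n::finite set set \<Rightarrow> (real^'n^'n) set" where
  "graph_matrices_cl0 G =
     {A. sym_matrix A \<and> (\<forall>i. A $ i $ i = 0) \<and>
         (\<forall>i j. i \<noteq> j \<longrightarrow> {i, j} \<notin> G \<longrightarrow> A $ i $ j = 0)}"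

definition has_SSP :: "real^'n^'n \<Rightarrow> bool" where
  "has_SSP A \<longleftrightarrow> sym_matrix A \<and>
     (\<forall>X. sym_matrix X \<and> hadamard A X = 0 \<and> hadamard (mat 1) X = 0 \<and> A ** X - X ** A = 0
        \<longrightarrow> X = 0)"

definition has_SSP_wrt :: "real^'n^'n \<Rightarrow> 'n set set \<Rightarrow> 'n set set \<Rightarrow> bool" where
  "has_SSP_wrt A G G' \<longleftrightarrow> A \<in> graph_matrices G \<and> G \<subseteq> G' \<and>
     (\<forall>X \<in> graph_matrices_cl0 (complement G'). A ** X - X ** A = 0 \<longrightarrow> X = 0)"

definition SSP_liberation_set :: "'n::finite set set \<Rightarrow> real^'n^'n \<Rightarrow> 'n set set \<Rightarrow> bool" where
  "SSP_liberation_set G A \<beta> \<longleftrightarrow> \<beta> \<noteq> {} \<and> \<beta> \<subseteq> complement G \<and>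
     (\<forall>\<beta>'. \<beta>' \<subset> \<beta> \<and> card \<beta>' = card \<beta> - 1 \<longrightarrow> has_SSP_wrt A G (G \<union> \<beta>'))"

text \<open>The set \<open>\<R>(A)\<close>.\<close>

definition SSP_obstructions :: "real^'n^'n \<Rightarrow> (real^'n^'n) set" where
  "SSP_obstructions A =
     {X. sym_matrix X \<and> hadamard A X = 0 \<and> hadamard (mat 1) X = 0 \<and> A ** X - X ** A = 0}"

text \<open>
  A vector indexed by a set of edges \<open>F\<close> is a function on vertex sets of which only the values
  on \<open>F\<close> matter. The entry of \<open>edge_vec X\<close> at the edge \<open>{i, j}\<close> with \<open>i < j\<close> is the
  \<open>(i, j)\<close> entry of \<open>X\<close>.
\<close>

definition edge_vec ::
  "real^'n::{finite,linorder}^'n::{finite,linorder} \<Rightarrow> 'n set \<Rightarrow> real" where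
  "edge_vec X e = X $ Min e $ Max e"

definition edge_inner :: "'n::finite set set \<Rightarrow> ('n set \<Rightarrow> real) \<Rightarrow> ('n set \<Rightarrow> real) \<Rightarrow> real" where
  "edge_inner F x y = (\<Sum>e\<in>F. x e * y e)"

definition edge_supp :: "'n::finite set set \<Rightarrow> ('n set \<Rightarrow> real) \<Rightarrow> 'n set set" where
  "edge_supp F x = {e \<in> F. x e \<noteq> 0}"

text \<open>
  The spectrum is the multiset of complex roots of the characteristic polynomial, which has
  size \<open>CARD('n)\<close>; for symmetric matrices all its members are real.
\<close>

definition charpoly :: "real^'n^'n \<Rightarrow> complex poly" where
  "charpoly A = det (mat [:0, 1:] - (\<chi> i j. [:complex_of_real (A $ i $ j):]))"

definition spec :: "real^'n^'n \<Rightarrow> complex multiset" where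
  "spec A = proots (charpoly A)"

text \<open>Submultiplicativity is not required, so every convention for matrix norms is covered.\<close>

definition matrix_norm :: "(real^'n^'n \<Rightarrow> real) \<Rightarrow> bool" where
  "matrix_norm N \<longleftrightarrow>
     (\<forall>A. N A \<ge> 0) \<and> (\<forall>A. N A = 0 \<longleftrightarrow> A = 0) \<and>
     (\<forall>c A. N (c *\<^sub>R A) = \<bar>c\<bar> * N A) \<and> (\<forall>A B. N (A + B) \<le> N A + N B)"

end

theory Submission
  imports Defs
begin

text \<open>
  Write \<open>X \<bullet> Y\<close> for the entrywise inner product of matrices and \<open>H = G \<union> \<beta>\<close>. Moving \<open>A\<close> inside its
  isospectral class means conjugating it by orthogonal matrices, so to first order \<open>A\<close> moves along
  the commutators \<open>A K - K A\<close> with \<open>K\<close> skew-symmetric. The symmetric matrices orthogonal to all of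
  these commute with \<open>A\<close>, and those orthogonal to every matrix with pattern \<open>G\<close> and free diagonal
  vanish on the diagonal and on \<open>G\<close>; \<open>\<R>(A)\<close> is the intersection of the two. Since the symmetric
  matrix with off-diagonal entries \<open>x\<close> is orthogonal to \<open>\<R>(A)\<close>, some commutator \<open>Y\<^sub>0\<close> agrees with
  \<open>x\<close> on all non-edges of \<open>G\<close> (\<open>first_order_solvable\<close>). Moving along it creates the edges of \<open>\<beta>\<close>
  with the signs of \<open>x\<close>, and on the remaining non-edges the error is of second order.

  The second-order error has to be removed without leaving the isospectral class. The liberation
  hypothesis gives the strong spectral property of \<open>A\<close> with respect to \<open>H\<close>, which by the same
  orthogonality argument says that every symmetric matrix is a matrix with pattern \<open>H\<close> plus a
  commutator. Hence the linearized problem can be solved for every right-hand side.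
  To avoid matrix exponentials and inverses, isospectrality is expressed by the polynomial equation
  \<open>(1 + K) B (1 - K) = (1 - K) A (1 + K)\<close>, the Cayley transform with denominators cleared.
  After scaling by \<open>t\<close> it becomes a fixed-point problem whose map is constant at \<open>t = 0\<close>, and
  Brouwer's theorem yields isospectral matrices \<open>A + t V(t)\<close> of pattern \<open>H\<close> with
  \<open>V(t) \<longlonglongrightarrow> Y\<^sub>0\<close> as \<open>t\<close> tends to \<open>0\<close> from above (\<open>isospectral_family\<close>).

  For small \<open>t\<close> the remaining claims are open conditions: the entries on \<open>G\<close> keep their signs, those on
  \<open>\<beta>\<close> are \<open>t\<close> times a number close to \<open>x\<close>, and if a linear subspace contains no nonzero matrix
  commuting with \<open>A\<close>, the same holds for all matrices near \<open>A\<close> (\<open>trivial_centralizer_eventually\<close>).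
  For a matrix whose graph is exactly \<open>H\<close>, that last condition is its strong spectral property.
\<close>

section \<open>Algebra of real matrices\<close>

lemma bounded_bilinear_matrix_mult:
  "bounded_bilinear ((**) :: real^'m^'n \<Rightarrow> real^'k^'m \<Rightarrow> real^'k^'n)"
  unfolding bilinear_conv_bounded_bilinear[symmetric] bilinear_def linear_iff
  by (simp add: matrix_add_ldistrib matrix_matrix_mult_def vec_eq_iff sum.distrib
      algebra_simps sum_distrib_left)

interpretation matrix_mult:
  bounded_bilinear "(**) :: real^'m^'n \<Rightarrow> real^'k^'m \<Rightarrow> real^'k^'n"
  by (rule bounded_bilinear_matrix_mult)

lemmas matrix_mult_expand =
  matrix_mult.add_left matrix_mult.add_right matrix_mult.diff_left matrix_mult.diff_right
  matrix_mult.minus_left matrix_mult.minus_right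
  matrix_mult.scaleR_left matrix_mult.scaleR_right

lemma transpose_add: "transpose (X + Y) = transpose X + transpose (Y :: real^'n^'m)"
  and transpose_diff: "transpose (X - Y) = transpose X - transpose (Y :: real^'n^'m)"
  and transpose_minus: "transpose (- Y) = - transpose (Y :: real^'n^'m)"
  by (simp_all add: transpose_def vec_eq_iff)

lemmas transpose_expand =
  transpose_add transpose_diff transpose_minus transpose_scalar matrix_transpose_mul

lemma sym_matrix_nth: "sym_matrix X \<Longrightarrow> X $ i $ j = X $ j $ i"
  unfolding sym_matrix_def transpose_def by (drule arg_cong[where f = "\<lambda>M. M $ j $ i"]) simp

lemma inner_matrix: "X \<bullet> Y = (\<Sum>i\<in>UNIV. \<Sum>j\<in>UNIV. X $ i $ j * Y $ i $ j)"
  for X Y :: "real^'n^'m"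
  by (simp add: inner_vec_def)

lemma inner_matrix_transpose: "transpose X \<bullet> transpose Y = X \<bullet> Y"
  for X Y :: "real^'n^'m"
  unfolding inner_matrix by (subst sum.swap) (simp add: transpose_def)

lemma inner_matrix_mult_left: "(X ** Y) \<bullet> Z = Y \<bullet> (transpose X ** Z)"
  for Z :: "real^'n^'m"
proof -
  have "(X ** Y) \<bullet> Z = (\<Sum>i\<in>UNIV. \<Sum>j\<in>UNIV. \<Sum>k\<in>UNIV. X$i$k * Y$k$j * Z$i$j)"
    by (simp add: inner_matrix matrix_matrix_mult_def sum_distrib_right)
  also have "\<dots> = (\<Sum>i\<in>UNIV. \<Sum>k\<in>UNIV. \<Sum>j\<in>UNIV. X$i$k * Y$k$j * Z$i$j)"
    by (intro sum.cong refl sum.swap)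
  also have "\<dots> = (\<Sum>k\<in>UNIV. \<Sum>i\<in>UNIV. \<Sum>j\<in>UNIV. X$i$k * Y$k$j * Z$i$j)"
    by (rule sum.swap)
  also have "\<dots> = (\<Sum>k\<in>UNIV. \<Sum>j\<in>UNIV. \<Sum>i\<in>UNIV. X$i$k * Y$k$j * Z$i$j)"
    by (intro sum.cong refl sum.swap)
  also have "\<dots> = Y \<bullet> (transpose X ** Z)"
    by (simp add: inner_matrix matrix_matrix_mult_def transpose_def sum_distrib_left mult_ac)
  finally show ?thesis .
qed

lemma inner_matrix_mult_right: "(X ** Y) \<bullet> Z = X \<bullet> (Z ** transpose Y)"
  for Z :: "real^'n^'m"
  using inner_matrix_mult_left[of "transpose Y" "transpose X" "transpose Z"]
  by (metis inner_matrix_transpose matrix_transpose_mul transpose_transpose)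

section \<open>A polynomial certificate for equal spectra\<close>

text \<open>
  As \<open>P\<close> and \<open>Q\<close> commute, the hypothesis extends from \<open>B\<close>, \<open>A\<close> to \<open>z - B\<close>, \<open>z - A\<close>:
  both \<open>P (z - B) Q\<close> and \<open>Q (z - A) P\<close> equal \<open>z P Q - P B Q\<close>. Taking determinants, the nonzero
  factors \<open>det P\<close> and \<open>det Q\<close> cancel.
\<close>

lemma charpoly_eq_intertwined:
  fixes A B P Q :: "real^'n^'n"
  assumes eq: "P ** B ** Q = Q ** A ** P" and comm: "P ** Q = Q ** P"
    and inv: "invertible P" "invertible Q"
  shows "charpoly B = charpoly A"
proof -
  define C :: "real^'n^'n \<Rightarrow> complex poly^'n^'n"
    where "C = (\<lambda>M. \<chi> i j. [:complex_of_real (M $ i $ j):])"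
  define z :: "complex poly^'n^'n" where "z = mat [:0, 1:]"
  have C_mult: "C (M ** N) = C M ** C N" for M N
    by (simp add: C_def matrix_matrix_mult_def vec_eq_iff sum_to_poly mult.commute)
  have z_comm: "M ** z = z ** M" for M
    by (simp add: z_def matrix_matrix_mult_def mat_def vec_eq_iff if_distrib if_distribR
        cong: if_cong)
  have det_C: "det (C M) \<noteq> 0" if "invertible M" for M
  proof -
    from that obtain M' where "M ** M' = mat 1"
      by (auto simp: invertible_def)
    then have "C M ** C M' = C (mat 1)"
      by (simp add: C_mult[symmetric])
    also have "C (mat 1) = mat 1"
      by (simp add: C_def mat_def vec_eq_iff one_pCons)
    finally have "det (C M) * det (C M') = 1"
      by (metis det_mul det_I)
    then show ?thesis by auto
  qed
  have sub_r: "M ** (U - V) = M ** U - M ** V" and sub_l: "(U - V) ** M = U ** M - V ** M"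
    for M U V :: "complex poly^'n^'n"
    by (simp_all add: matrix_matrix_mult_def vec_eq_iff sum_subtractf algebra_simps)
  have expand: "C M ** (z - C D) ** C N = z ** C (M ** N) - C (M ** D ** N)" for M D N
    by (simp add: sub_l sub_r C_mult z_comm matrix_mul_assoc)
  have "C P ** (z - C B) ** C Q = C Q ** (z - C A) ** C P"
    by (simp add: expand eq comm)
  then have "det (C P) * det (z - C B) * det (C Q) = det (C Q) * det (z - C A) * det (C P)"
    by (metis det_mul)
  then have "(det (C P) * det (C Q)) * det (z - C B) = (det (C P) * det (C Q)) * det (z - C A)"
    by (simp add: mult_ac)
  then have "det (z - C B) = det (z - C A)"
    using det_C inv by simp
  then show ?thesis
    by (simp add: charpoly_def C_def z_def)
qed

definition skew_matrices :: "(real^'n^'n) set" where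
  "skew_matrices = {K. transpose K = - K}"

text \<open>If \<open>(1 + K) v = 0\<close> then \<open>v \<bullet> v = - (v \<bullet> K v) = 0\<close>, because a skew form vanishes on the diagonal.\<close>

lemma invertible_one_plus_skew:
  assumes "K \<in> skew_matrices"
  shows "invertible (mat 1 + K)"
proof -
  have "v = 0" if "(mat 1 + K) *v v = 0" for v
  proof -
    have "v \<bullet> (K *v v) = (transpose K *v v) \<bullet> v"
      by (simp add: dot_lmul_matrix)
    also have "\<dots> = - (v \<bullet> (K *v v))"
    proof -
      have "(- K) *v v = - (K *v v)"
        by (simp add: matrix_vector_mult_def vec_eq_iff sum_negf)
      then show ?thesis
        using assms by (simp add: skew_matrices_def inner_commute del: transpose_matrix_vector)
    qed
    finally have "v \<bullet> (K *v v) = 0" by simp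
    moreover have "v + K *v v = 0"
      using that by (simp add: matrix_vector_mult_add_rdistrib)
    ultimately have "v \<bullet> v = 0"
      by (metis add.right_neutral inner_add_right inner_zero_right)
    then show ?thesis by simp
  qed
  then obtain L where "L ** (mat 1 + K) = mat 1"
    using matrix_left_invertible_ker[of "mat 1 + K"] by blast
  then show ?thesis
    using invertible_left_inverse by blast
qed

text \<open>
  The equation is \<open>(1 + K) (A + Y) (1 - K) = (1 - K) A (1 + K)\<close>, expanded and sorted into its linear
  part in \<open>(Y, K)\<close>, whose solvability is a question of linear algebra, and terms of higher order. It
  says that the orthogonal matrix \<open>(1 + K) (1 - K)\<^sup>-\<^sup>1\<close> conjugates \<open>A\<close> to \<open>A + Y\<close>.
\<close>

lemma charpoly_eq_Cayley:
  fixes A Y K :: "real^'n^'n"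
  assumes K: "K \<in> skew_matrices"
    and eq: "Y + 2 *\<^sub>R (K ** A - A ** K) + (K ** Y - Y ** K - K ** Y ** K) = 0"
  shows "charpoly (A + Y) = charpoly A"
proof (rule charpoly_eq_intertwined)
  have "(mat 1 + K) ** (A + Y) ** (mat 1 - K) - (mat 1 - K) ** A ** (mat 1 + K)
      = Y + 2 *\<^sub>R (K ** A - A ** K) + (K ** Y - Y ** K - K ** Y ** K)"
    by (simp add: matrix_mult_expand scaleR_2 algebra_simps)
  then show "(mat 1 + K) ** (A + Y) ** (mat 1 - K) = (mat 1 - K) ** A ** (mat 1 + K)"
    using eq by simp
  show "(mat 1 + K) ** (mat 1 - K) = (mat 1 - K) ** (mat 1 + K)"
    by (simp add: matrix_mult_expand)
  show "invertible (mat 1 + K)"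
    using K by (rule invertible_one_plus_skew)
  have "- K \<in> skew_matrices"
    using K by (simp add: skew_matrices_def transpose_minus)
  then show "invertible (mat 1 - K)"
    using invertible_one_plus_skew[of "- K"] by simp
qed

section \<open>First-order perturbations and their obstructions\<close>

text \<open>
  The topological closure of \<^term>\<open>graph_matrices H\<close>. In contrast to \<^const>\<open>graph_matrices_cl0\<close>, the
  diagonal is free.
\<close>

definition graph_matrices_cl :: "'n::finite set set \<Rightarrow> (real^'n^'n) set" where
  "graph_matrices_cl H = {Y. sym_matrix Y \<and> (\<forall>i j. i \<noteq> j \<longrightarrow> {i, j} \<notin> H \<longrightarrow> Y $ i $ j = 0)}"

lemma subspace_skew_matrices: "subspace (skew_matrices :: (real^'n^'n) set)"
  by (rule subspaceI) (auto simp: skew_matrices_def transpose_expand transpose_def[of 0] vec_eq_iff)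

lemma subspace_graph_matrices_cl: "subspace (graph_matrices_cl H)"
  by (rule subspaceI)
    (auto simp: graph_matrices_cl_def sym_matrix_def transpose_expand transpose_def[of 0] vec_eq_iff)

lemma subspace_graph_matrices_cl0: "subspace (graph_matrices_cl0 H)"
  by (rule subspaceI)
    (auto simp: graph_matrices_cl0_def sym_matrix_def transpose_expand transpose_def[of 0] vec_eq_iff)

lemma linear_perturbation:
  "linear (\<lambda>(Y, K). Y + 2 *\<^sub>R (K ** A - A ** K))" for A :: "real^'n^'n"
  by (rule linearI) (auto simp: matrix_mult_expand algebra_simps)

text \<open>Testing against the symmetric matrix units \<open>E\<^sub>i\<^sub>j + E\<^sub>j\<^sub>i\<close> reads off the entries of \<open>X\<close>.\<close>

lemma orthogonal_graph_matrices_cl: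
  fixes X :: "real^'n^'n"
  assumes X: "sym_matrix X" and orth: "\<And>Y. Y \<in> graph_matrices_cl H \<Longrightarrow> X \<bullet> Y = 0"
  shows "X \<in> graph_matrices_cl0 (complement H)"
proof -
  have zero: "X $ i $ j = 0" if ij: "i = j \<or> {i, j} \<in> H" for i j
  proof -
    define E :: "real^'n^'n" where "E = (\<chi> k. if k = i then axis j 1 else 0)"
    have E: "E $ k $ l = (if k = i \<and> l = j then 1 else 0)" for k l
      by (auto simp: E_def axis_def)
    have "E + transpose E \<in> graph_matrices_cl H"
      unfolding graph_matrices_cl_def
    proof (intro CollectI conjI allI impI)
      show "sym_matrix (E + transpose E)"
        by (simp add: sym_matrix_def transpose_add add.commute)
      fix k l assume "k \<noteq> l" "{k, l} \<notin> H"
      have "{k, l} \<noteq> {i, j}"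
      proof
        assume eq: "{k, l} = {i, j}"
        with \<open>k \<noteq> l\<close> have "i \<noteq> j"
          by (metis doubleton_eq_iff)
        with ij eq \<open>{k, l} \<notin> H\<close> show False
          by simp
      qed
      then have "E $ k $ l = 0" "E $ l $ k = 0"
        unfolding E by auto
      then show "(E + transpose E) $ k $ l = 0"
        by (simp add: transpose_def)
    qed
    then have "X \<bullet> E + X \<bullet> transpose E = 0"
      using orth by (metis inner_add_right)
    moreover have "X \<bullet> transpose E = X \<bullet> E"
      using X inner_matrix_transpose[of X E] by (simp add: sym_matrix_def)
    moreover have "X \<bullet> E = X $ i $ j"
    proof -
      have "X \<bullet> E = (\<Sum>k\<in>UNIV. if k = i then X $ k $ j else 0)"
        unfolding inner_matrix
        by (intro sum.cong refl) (simp add: E if_distrib cong: if_cong)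
      then show ?thesis by simp
    qed
    ultimately show ?thesis by simp
  qed
  have "{i, j} \<in> H" if "i \<noteq> j" "{i, j} \<notin> complement H" for i j
    using that by (simp add: complement_def)
  with zero X show ?thesis
    unfolding graph_matrices_cl0_def by blast
qed

text \<open>The commutator \<open>A X - X A\<close> is itself skew; testing with \<open>K = A X - X A\<close> gives minus its squared norm.\<close>

lemma orthogonal_commutators_skew:
  fixes A X :: "real^'n^'n"
  assumes A: "sym_matrix A" and X: "sym_matrix X"
    and orth: "\<And>K. K \<in> skew_matrices \<Longrightarrow> X \<bullet> (K ** A - A ** K) = 0"
  shows "A ** X - X ** A = 0"
proof -
  let ?K = "A ** X - X ** A"
  have "?K \<in> skew_matrices"
    using A X by (simp add: skew_matrices_def sym_matrix_def transpose_expand)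
  then have "0 = (?K ** A - A ** ?K) \<bullet> X"
    using orth by (simp add: inner_commute)
  also have "\<dots> = ?K \<bullet> (X ** A) - ?K \<bullet> (A ** X)"
    using A by (simp add: inner_diff_left inner_matrix_mult_right[of ?K A]
        inner_matrix_mult_left[of A ?K] sym_matrix_def)
  also have "\<dots> = - (?K \<bullet> ?K)"
    by (simp add: inner_diff_right)
  finally show ?thesis by simp
qed

text \<open>
  The right-hand sides of the linearized equation form a subspace of the symmetric matrices, and
  the two preceding lemmas show that its orthogonal complement there consists of the matrices \<open>X\<close>
  of the hypothesis. The lemma serves twice: with \<open>H = G\<close> it provides the direction in which \<open>A\<close>
  starts to move, and for a graph \<open>H\<close> where only \<open>X = 0\<close> qualifies it makes the linearized equation
  solvable for every symmetric \<open>B\<close>.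
\<close>

lemma first_order_solvable:
  fixes A B :: "real^'n^'n"
  assumes A: "sym_matrix A" and B: "sym_matrix B"
    and orth: "\<And>X. X \<in> graph_matrices_cl0 (complement H) \<Longrightarrow> A ** X - X ** A = 0 \<Longrightarrow> B \<bullet> X = 0"
  obtains Y K where "Y \<in> graph_matrices_cl H" "K \<in> skew_matrices"
    "B = Y + 2 *\<^sub>R (K ** A - A ** K)"
proof -
  let ?L = "\<lambda>(Y, K). Y + 2 *\<^sub>R (K ** A - A ** K)"
  define S where "S = ?L ` (graph_matrices_cl H \<times> skew_matrices)"
  have sub: "subspace S"
    unfolding S_def
    by (intro linear_subspace_image linear_perturbation subspace_Times
        subspace_graph_matrices_cl subspace_skew_matrices)
  obtain y z where y: "y \<in> span S" and z: "\<And>w. w \<in> span S \<Longrightarrow> orthogonal z w"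
    and Byz: "B = y + z"
    using orthogonal_subspace_decomp_exists by blast
  have yS: "y \<in> S" and zS: "\<And>w. w \<in> S \<Longrightarrow> z \<bullet> w = 0"
    using y z span_eq_iff[THEN iffD2, OF sub] by (auto simp: orthogonal_def)
  have "sym_matrix y"
    using yS A by (auto simp: S_def graph_matrices_cl_def skew_matrices_def sym_matrix_def
        transpose_expand matrix_mult_expand)
  then have symz: "sym_matrix z"
    using B Byz by (metis add_diff_cancel_left' sym_matrix_def transpose_diff)
  have "z \<in> graph_matrices_cl0 (complement H)"
  proof (rule orthogonal_graph_matrices_cl[OF symz])
    fix Y assume "Y \<in> graph_matrices_cl H"
    then have "?L (Y, 0) \<in> S"
      unfolding S_def by (intro imageI) (simp add: subspace_0[OF subspace_skew_matrices])
    then show "z \<bullet> Y = 0"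
      using zS by (simp add: matrix_mult.zero_left matrix_mult.zero_right)
  qed
  moreover have "A ** z - z ** A = 0"
  proof (rule orthogonal_commutators_skew[OF A symz])
    fix K :: "real^'n^'n" assume "K \<in> skew_matrices"
    then have "?L (0, K) \<in> S"
      unfolding S_def by (intro imageI) (simp add: subspace_0[OF subspace_graph_matrices_cl])
    then show "z \<bullet> (K ** A - A ** K) = 0"
      using zS by fastforce
  qed
  ultimately have "B \<bullet> z = 0"
    by (rule orth)
  moreover have "y \<bullet> z = 0"
    using zS yS by (simp add: inner_commute)
  ultimately have "z = 0"
    using Byz by (simp add: inner_add_left)
  then have "B \<in> S"
    using Byz yS by simp
  then show ?thesis
    using that by (auto simp: S_def)
qed

section \<open>From first order to an isospectral family\<close>

text \<open>
  Let \<open>g\<close> be a linear right inverse of \<open>L(Y, K) = Y + 2 (K A - A K)\<close>. Substituting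
  \<open>t (Y\<^sub>0, K\<^sub>0) + t\<^sup>2 g(W)\<close> for \<open>(Y, K)\<close> in the equation of \<open>charpoly_eq_Cayley\<close>, the linear part
  becomes \<open>t\<^sup>2 W\<close> because \<open>L(Y\<^sub>0, K\<^sub>0) = 0\<close>, and the other terms are divisible by \<open>t\<^sup>2\<close> as well.
  Dividing by \<open>t\<^sup>2\<close> leaves a fixed-point equation \<open>W = F(t, W)\<close>.
\<close>

lemma isospectral_family:
  fixes A :: "real^'n^'n"
  assumes A: "sym_matrix A"
    and onto: "\<And>X. X \<in> graph_matrices_cl0 (complement H) \<Longrightarrow> A ** X - X ** A = 0 \<Longrightarrow> X = 0"
    and Y0: "Y0 \<in> graph_matrices_cl H" and K0: "K0 \<in> skew_matrices"
    and tangent: "Y0 + 2 *\<^sub>R (K0 ** A - A ** K0) = 0"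
  obtains V where "(V \<longlongrightarrow> Y0) (at_right 0)"
    "\<forall>\<^sub>F t in at_right 0. V t \<in> graph_matrices_cl H \<and> charpoly (A + t *\<^sub>R V t) = charpoly A"
proof -
  let ?L = "\<lambda>(Y, K). Y + 2 *\<^sub>R (K ** A - A ** K)"
  let ?S = "graph_matrices_cl H \<times> skew_matrices"
  obtain g where gS: "range g \<subseteq> ?S" and "linear g" and g: "\<forall>B\<in>?L ` ?S. ?L (g B) = B"
    using linear_exists_right_inverse_on[OF linear_perturbation[of A], of ?S]
    by (auto simp: subspace_Times subspace_graph_matrices_cl subspace_skew_matrices)
  have right_inv: "fst (g W) + 2 *\<^sub>R (snd (g W) ** A - A ** snd (g W)) = W" if W: "sym_matrix W" for W
  proof -
    obtain Y K where "Y \<in> graph_matrices_cl H" "K \<in> skew_matrices"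
      "W = Y + 2 *\<^sub>R (K ** A - A ** K)"
      using first_order_solvable[OF A W, of H] onto by (metis inner_zero_right)
    then have "W \<in> ?L ` ?S"
      by force
    then have "?L (g W) = W"
      using g by blast
    then show ?thesis
      by (simp add: case_prod_beta)
  qed
  have "linear (\<lambda>W. fst (g W))" "linear (\<lambda>W. snd (g W))"
    using \<open>linear g\<close> by (auto simp: linear_iff)
  then have bl: "bounded_linear (\<lambda>W. fst (g W))" "bounded_linear (\<lambda>W. snd (g W))"
    by (simp_all add: linear_conv_bounded_linear)
  define Y K where "Y = (\<lambda>t W. Y0 + t *\<^sub>R fst (g W))" and "K = (\<lambda>t W. K0 + t *\<^sub>R snd (g W))"
  have Y_cl: "Y t W \<in> graph_matrices_cl H" and K_skew: "K t W \<in> skew_matrices" for t W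
  proof -
    have "fst (g W) \<in> graph_matrices_cl H" "snd (g W) \<in> skew_matrices"
      using gS by (force simp: image_subset_iff mem_Times_iff)+
    then show "Y t W \<in> graph_matrices_cl H" "K t W \<in> skew_matrices"
      using Y0 K0 by (simp_all add: Y_def K_def subspace_add subspace_scale
          subspace_graph_matrices_cl subspace_skew_matrices)
  qed
  \<comment> \<open>The fixed-point map lives on all matrices, but its values, and hence its fixed points, are symmetric.\<close>
  define F where "F = (\<lambda>t W. t *\<^sub>R (K t W ** Y t W ** K t W) - K t W ** Y t W + Y t W ** K t W)"
  have symF: "sym_matrix (F t W)" for t W
    using Y_cl[of t W] K_skew[of t W]
    by (simp add: F_def graph_matrices_cl_def skew_matrices_def sym_matrix_def
        transpose_expand matrix_mult_expand matrix_mul_assoc)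
  have contF: "continuous_on UNIV (\<lambda>p. F (fst p) (snd p))"
    unfolding F_def Y_def K_def
    by (intro continuous_intros matrix_mult.continuous_on
        bounded_linear.continuous_on[OF bl(1)] bounded_linear.continuous_on[OF bl(2)])
  \<comment> \<open>The map \<open>F 0\<close> is constant. By uniform continuity \<open>F t\<close> stays within distance \<open>1\<close> of it for small
    \<open>t\<close>, so that \<open>F t\<close> maps the ball of radius \<open>r\<close> into itself.\<close>
  define r where "r = norm (F 0 0) + 1"
  have "r > 0"
    by (simp add: r_def add_nonneg_pos)
  have F0: "F 0 W = F 0 0" for W
    by (simp add: F_def Y_def K_def)
  let ?D = "{0..1::real} \<times> cball (0 :: real^'n^'n) r"
  have "uniformly_continuous_on ?D (\<lambda>p. F (fst p) (snd p))"
    by (intro compact_uniformly_continuous continuous_on_subset[OF contF] compact_Times) auto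
  then obtain d where "d > 0"
    and d: "\<And>p q. p \<in> ?D \<Longrightarrow> q \<in> ?D \<Longrightarrow> dist q p < d \<Longrightarrow>
      dist (F (fst q) (snd q)) (F (fst p) (snd p)) < 1"
    unfolding uniformly_continuous_on_def by (metis zero_less_one)
  have fixpoint: "\<exists>W\<in>cball 0 r. F t W = W" if t: "0 < t" "t < min d 1" for t
  proof -
    have "F t W \<in> cball 0 r" if "W \<in> cball 0 r" for W
    proof -
      have "dist (F t W) (F 0 W) < 1"
        using d[of "(0, W)" "(t, W)"] that t by (simp add: dist_Pair_Pair)
      then show ?thesis
        using norm_triangle_ineq2[of "F t W" "F 0 0"] by (simp add: r_def dist_norm F0[of W])
    qed
    moreover have "continuous_on (cball 0 r) (F t)"
    proof -
      have "continuous_on UNIV (\<lambda>W. F (fst (t, W)) (snd (t, W)))"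
        by (rule continuous_on_compose2[OF contF]) (auto intro!: continuous_intros)
      then show ?thesis
        by (auto intro: continuous_on_subset)
    qed
    ultimately show ?thesis
      using brouwer[OF compact_cball convex_cball, of 0 r "F t"] \<open>r > 0\<close> by force
  qed
  then obtain W where W: "\<And>t. 0 < t \<Longrightarrow> t < min d 1 \<Longrightarrow> W t \<in> cball 0 r \<and> F t (W t) = W t"
    by metis
  have small: "\<forall>\<^sub>F t in at_right (0::real). 0 < t \<and> t < min d 1"
    using \<open>d > 0\<close> by (auto simp: eventually_at_right_field intro!: exI[of _ "min d 1"])
  show ?thesis
  proof (rule that[of "\<lambda>t. Y t (W t)"])
    obtain c where c: "\<And>W. norm (fst (g W)) \<le> norm W * c" and "c > 0"
      using bounded_linear.pos_bounded[OF bl(1)] by blast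
    show "((\<lambda>t. Y t (W t)) \<longlongrightarrow> Y0) (at_right 0)"
    proof (rule LIM_zero_cancel, rule Lim_null_comparison)
      show "\<forall>\<^sub>F t in at_right 0. norm (Y t (W t) - Y0) \<le> t * (r * c)"
        using small
      proof eventually_elim
        case (elim t)
        have "norm (fst (g (W t))) \<le> norm (W t) * c"
          by (rule c)
        also have "\<dots> \<le> r * c"
          using W[of t] elim \<open>c > 0\<close> by (intro mult_right_mono) auto
        finally show ?case
          using elim by (simp add: Y_def)
      qed
      show "((\<lambda>t. t * (r * c)) \<longlongrightarrow> 0) (at_right 0)"
        by (auto intro!: tendsto_eq_intros)
    qed
    show "\<forall>\<^sub>F t in at_right 0. Y t (W t) \<in> graph_matrices_cl H \<and>
        charpoly (A + t *\<^sub>R Y t (W t)) = charpoly A"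
      using small
    proof eventually_elim
      case (elim t)
      let ?Y = "Y t (W t)" and ?K = "K t (W t)"
      have fix_W: "F t (W t) = W t"
        using W elim by blast
      then have "fst (g (W t)) + 2 *\<^sub>R (snd (g (W t)) ** A - A ** snd (g (W t))) = W t"
        using right_inv symF by metis
      then have "?Y + 2 *\<^sub>R (?K ** A - A ** ?K) = t *\<^sub>R W t"
      proof -
        have "?Y + 2 *\<^sub>R (?K ** A - A ** ?K) = (Y0 + 2 *\<^sub>R (K0 ** A - A ** K0))
            + t *\<^sub>R (fst (g (W t)) + 2 *\<^sub>R (snd (g (W t)) ** A - A ** snd (g (W t))))"
          by (simp add: Y_def K_def matrix_mult_expand algebra_simps)
        then show ?thesis
          using tangent \<open>fst (g (W t)) + _ = W t\<close> by simp
      qed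
      moreover have "W t + (?K ** ?Y - ?Y ** ?K - t *\<^sub>R (?K ** ?Y ** ?K)) = 0"
        using fix_W by (simp add: F_def algebra_simps)
      ultimately have "t *\<^sub>R ((?Y + 2 *\<^sub>R (?K ** A - A ** ?K))
          + t *\<^sub>R (?K ** ?Y - ?Y ** ?K - t *\<^sub>R (?K ** ?Y ** ?K))) = 0"
        by (metis scaleR_right_distrib scaleR_zero_right)
      then have "t *\<^sub>R ?Y + 2 *\<^sub>R ((t *\<^sub>R ?K) ** A - A ** (t *\<^sub>R ?K)) +
          ((t *\<^sub>R ?K) ** (t *\<^sub>R ?Y) - (t *\<^sub>R ?Y) ** (t *\<^sub>R ?K)
            - (t *\<^sub>R ?K) ** (t *\<^sub>R ?Y) ** (t *\<^sub>R ?K)) = 0"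
        by (simp add: matrix_mult.scaleR_left matrix_mult.scaleR_right algebra_simps)
      then have "charpoly (A + t *\<^sub>R ?Y) = charpoly A"
        by (intro charpoly_eq_Cayley)
          (simp_all add: subspace_scale[OF subspace_skew_matrices K_skew])
      then show ?case
        using Y_cl by simp
    qed
  qed
qed

section \<open>Stability under small perturbations\<close>

text \<open>
  On a subspace where \<open>X \<mapsto> A X - X A\<close> is injective it is bounded below by some \<open>e \<parallel>X\<parallel>\<close>, while replacing
  \<open>A\<close> by \<open>M\<close> changes it by at most a constant times \<open>\<parallel>M - A\<parallel> \<parallel>X\<parallel>\<close>.
\<close>

lemma trivial_centralizer_eventually:
  fixes A :: "real^'n^'n" and S :: "(real^'n^'n) set"
  assumes S: "subspace S" and triv: "\<And>X. X \<in> S \<Longrightarrow> A ** X - X ** A = 0 \<Longrightarrow> X = 0"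
    and lim: "(M \<longlongrightarrow> A) F"
  shows "\<forall>\<^sub>F t in F. \<forall>X\<in>S. M t ** X - X ** M t = 0 \<longrightarrow> X = 0"
proof -
  have "bounded_linear (\<lambda>X. A ** X - X ** A)"
    by (intro bounded_linear_sub matrix_mult.bounded_linear_right matrix_mult.bounded_linear_left)
  from injective_imp_isometric[OF closed_subspace[OF S] S this] triv
  obtain e where "e > 0" and e: "\<And>X. X \<in> S \<Longrightarrow> e * norm X \<le> norm (A ** X - X ** A)"
    by blast
  obtain c where "c > 0" and c: "\<And>(X :: real^'n^'n) (Y :: real^'n^'n). norm (X ** Y) \<le> norm X * norm Y * c"
    using matrix_mult.pos_bounded by blast
  have "\<forall>\<^sub>F t in F. dist (M t) A < e / (2 * c)"
    using tendstoD[OF lim] \<open>e > 0\<close> \<open>c > 0\<close> by simp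
  then show ?thesis
  proof eventually_elim
    case (elim t)
    show ?case
    proof (intro ballI impI)
      fix X assume X: "X \<in> S" and "M t ** X - X ** M t = 0"
      define D where "D = A - M t"
      have "A ** X - X ** A = D ** X - X ** D"
        using \<open>M t ** X - X ** M t = 0\<close> by (simp add: D_def matrix_mult_expand)
      then have "e * norm X \<le> norm (D ** X - X ** D)"
        using e[OF X] by simp
      also have "\<dots> \<le> norm D * norm X * c + norm X * norm D * c"
        using norm_triangle_ineq4[of "D ** X" "X ** D"] c[of D X] c[of X D] by linarith
      finally have "e * norm X \<le> (2 * c * norm D) * norm X"
        by (simp add: algebra_simps)
      moreover have "2 * c * norm D < e"
        using elim \<open>c > 0\<close> by (simp add: D_def dist_norm norm_minus_commute field_simps)
      ultimately show "X = 0"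
        by (metis mult_le_cancel_right not_le zero_less_norm_iff norm_ge_zero)
    qed
  qed
qed

text \<open>Every norm is convex, and convex functions on a Euclidean space are continuous.\<close>

lemma continuous_matrix_norm:
  fixes N :: "real^'n^'n \<Rightarrow> real"
  assumes "matrix_norm N"
  shows "continuous_on UNIV N"
proof (rule convex_on_continuous)
  show "convex_on UNIV N"
  proof (rule convex_onI)
    fix t :: real and X Y :: "real^'n^'n" assume "0 < t" "t < 1"
    have "N ((1 - t) *\<^sub>R X + t *\<^sub>R Y) \<le> N ((1 - t) *\<^sub>R X) + N (t *\<^sub>R Y)"
      using assms unfolding matrix_norm_def by blast
    also have "\<dots> = (1 - t) * N X + t * N Y"
      using assms \<open>0 < t\<close> \<open>t < 1\<close> by (simp add: matrix_norm_def)
    finally show "N ((1 - t) *\<^sub>R X + t *\<^sub>R Y) \<le> (1 - t) * N X + t * N Y" .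
  qed auto
qed auto

lemma eventually_sgn_eq:
  fixes f :: "'a \<Rightarrow> real"
  assumes "(f \<longlongrightarrow> l) F" "l \<noteq> 0"
  shows "\<forall>\<^sub>F t in F. sgn (f t) = sgn l"
proof (cases "l > 0")
  case True
  then show ?thesis
    using order_tendstoD(1)[OF assms(1), of 0] by (auto elim: eventually_mono)
next
  case False
  then show ?thesis
    using assms(2) order_tendstoD(2)[OF assms(1), of 0] by (auto elim: eventually_mono)
qed

section \<open>Edge vectors and symmetric matrices\<close>

definition edge_matrix :: "'n::finite set set \<Rightarrow> ('n set \<Rightarrow> real) \<Rightarrow> real^'n^'n" where
  "edge_matrix F x = (\<chi> i j. if {i, j} \<in> F then x {i, j} else 0)"

lemma sym_edge_matrix: "sym_matrix (edge_matrix F x)"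
  by (simp add: sym_matrix_def edge_matrix_def transpose_def vec_eq_iff) (simp add: insert_commute)

text \<open>Each edge contributes two equal entries to the matrix inner product, hence the factor \<open>2\<close>.\<close>

lemma inner_edge_matrix:
  fixes X :: "real^'n::{finite,linorder}^'n::{finite,linorder}"
  assumes F: "\<And>e. e \<in> F \<Longrightarrow> card e = 2" and X: "sym_matrix X"
  shows "edge_matrix F x \<bullet> X = 2 * edge_inner F x (edge_vec X)"
proof -
  have sym: "X $ i $ j = X $ j $ i" for i j
    using X by (rule sym_matrix_nth)
  define h where "h = (\<lambda>(i, j). x {i, j} * X $ i $ j)"
  define P where "P = {(i, j). {i, j} \<in> F}"
  have fin: "finite P" "finite F"
    by simp_all
  have "edge_matrix F x \<bullet> X = (\<Sum>(i, j)\<in>UNIV \<times> UNIV. if {i, j} \<in> F then x {i, j} * X $ i $ j else 0)"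
    unfolding inner_matrix
    by (subst sum.cartesian_product) (auto simp: edge_matrix_def intro!: sum.cong)
  also have "\<dots> = sum h P"
    by (rule sum.mono_neutral_cong_right) (auto simp: P_def h_def split: if_splits)
  also have "\<dots> = (\<Sum>e\<in>F. sum h {p \<in> P. {fst p, snd p} = e})"
    using fin by (intro sum.group[symmetric]) (auto simp: P_def)
  also have "\<dots> = (\<Sum>e\<in>F. 2 * (x e * edge_vec X e))"
  proof (intro sum.cong refl)
    fix e assume e: "e \<in> F"
    then obtain a b where ab: "e = {a, b}" "a < b"
      using F[OF e] by (metis card_2_iff doubleton_eq_iff linorder_neqE)
    have "{p \<in> P. {fst p, snd p} = e} = {(a, b), (b, a)}"
      using ab e by (auto simp: P_def doubleton_eq_iff insert_commute)
    moreover have "edge_vec X e = X $ a $ b"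
      using ab by (simp add: edge_vec_def min_absorb1 max_absorb2 less_imp_le)
    ultimately show "sum h {p \<in> P. {fst p, snd p} = e} = 2 * (x e * edge_vec X e)"
      using ab sym[of a b] by (simp add: h_def insert_commute)
  qed
  finally show ?thesis
    by (simp add: edge_inner_def sum_distrib_left)
qed

lemma graph_matrices_cl0_complement_obstruction:
  assumes A: "A \<in> graph_matrices G" and X: "X \<in> graph_matrices_cl0 (complement G)"
    and comm: "A ** X - X ** A = 0"
  shows "X \<in> SSP_obstructions A"
proof -
  have "A $ i $ j * X $ i $ j = 0" for i j
  proof (cases "i = j \<or> {i, j} \<in> G")
    case True
    then have "X $ i $ j = 0"
      using X by (cases "i = j") (auto simp: graph_matrices_cl0_def complement_def)
    then show ?thesis by simp
  next
    case False
    then have "A $ i $ j = 0"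
      using A unfolding graph_matrices_def by blast
    then show ?thesis by simp
  qed
  moreover have "mat 1 $ i $ j * X $ i $ j = 0" for i j
    using X by (auto simp: graph_matrices_cl0_def mat_def)
  ultimately show ?thesis
    using X comm by (simp add: SSP_obstructions_def hadamard_def vec_eq_iff graph_matrices_cl0_def)
qed

lemma has_SSP_if_trivial_centralizer:
  assumes A: "A \<in> graph_matrices H"
    and triv: "\<And>X. X \<in> graph_matrices_cl0 (complement H) \<Longrightarrow> A ** X - X ** A = 0 \<Longrightarrow> X = 0"
  shows "has_SSP A"
  unfolding has_SSP_def
proof (intro conjI allI impI)
  show "sym_matrix A"
    using A by (simp add: graph_matrices_def)
  fix X assume *: "sym_matrix X \<and> hadamard A X = 0 \<and> hadamard (mat 1) X = 0 \<and> A ** X - X ** A = 0"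
  have diag: "X $ i $ i = 0" for i
  proof -
    have "hadamard (mat 1) X $ i $ i = 0"
      using * by simp
    then show ?thesis
      by (simp add: hadamard_def mat_def)
  qed
  have off: "X $ i $ j = 0" if "i \<noteq> j" "{i, j} \<notin> complement H" for i j
  proof -
    have "hadamard A X $ i $ j = 0"
      using * by simp
    moreover have "A $ i $ j \<noteq> 0"
      using A that by (simp add: graph_matrices_def complement_def)
    ultimately show ?thesis
      by (simp add: hadamard_def)
  qed
  show "X = 0"
  proof (rule triv)
    show "X \<in> graph_matrices_cl0 (complement H)"
      unfolding graph_matrices_cl0_def using * diag off by blast
    show "A ** X - X ** A = 0"
      using * by blast
  qed
qed

text \<open>
  Removing one edge of the nonempty set \<open>\<beta>\<close> gives one of the sets \<open>\<beta>'\<close> in the definition of a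
  liberation set, and the property passes to larger supergraphs since fewer matrices \<open>X\<close> have to be
  excluded.
\<close>

lemma has_SSP_wrt_liberation_set:
  assumes "SSP_liberation_set G A \<beta>"
  shows "has_SSP_wrt A G (G \<union> \<beta>)"
proof -
  obtain e where e: "e \<in> \<beta>"
    using assms by (auto simp: SSP_liberation_set_def)
  then have "\<beta> - {e} \<subset> \<beta>" "card (\<beta> - {e}) = card \<beta> - 1"
    by auto
  then have wrt: "has_SSP_wrt A G (G \<union> (\<beta> - {e}))"
    using assms by (simp add: SSP_liberation_set_def)
  have "graph_matrices_cl0 (complement (G \<union> \<beta>)) \<subseteq> graph_matrices_cl0 (complement (G \<union> (\<beta> - {e})))"
    by (auto simp: graph_matrices_cl0_def complement_def)
  with wrt show ?thesis
    by (auto simp: has_SSP_wrt_def)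
qed

section \<open>Liberation\<close>

theorem theorem3p8:
  fixes G :: "'n::{finite,linorder} set set"
    and A :: "real^'n::{finite,linorder}^'n::{finite,linorder}"
    and \<beta> :: "'n set set"
    and x :: "'n set \<Rightarrow> real"
    and N :: "real^'n::{finite,linorder}^'n::{finite,linorder} \<Rightarrow> real"
  assumes "simple_graph G"
    and "A \<in> graph_matrices G"
    and "\<beta> \<subseteq> complement G"
    and "SSP_liberation_set G A \<beta>"
    and "edge_supp (complement G) x = \<beta>"
    and "\<forall>X \<in> SSP_obstructions A. edge_inner (complement G) x (edge_vec X) = 0"
    and "matrix_norm N"
  shows "\<forall>\<epsilon>::real. \<epsilon> > 0 \<longrightarrow>
    (\<exists>A' \<in> graph_matrices (G \<union> \<beta>).
       spec A' = spec A \<and>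
       has_SSP A' \<and>
       N (A' - A) < \<epsilon> \<and>
       (\<forall>i j. {i, j} \<in> \<beta> \<longrightarrow> sgn (A' $ i $ j) = sgn (x {i, j})) \<and>
       (\<forall>i j. i \<noteq> j \<and> {i, j} \<notin> \<beta> \<longrightarrow> sgn (A' $ i $ j) = sgn (A $ i $ j)))"
proof (intro allI impI)
  fix \<epsilon> :: real assume "\<epsilon> > 0"
  let ?H = "G \<union> \<beta>" and ?B = "edge_matrix (complement G) x"
  have symA: "sym_matrix A"
    using assms(2) by (simp add: graph_matrices_def)
  have triv: "X = 0" if "X \<in> graph_matrices_cl0 (complement ?H)" "A ** X - X ** A = 0" for X
    using has_SSP_wrt_liberation_set[OF assms(4)] that by (auto simp: has_SSP_wrt_def)
  have "?B \<bullet> X = 0" if "X \<in> graph_matrices_cl0 (complement G)" "A ** X - X ** A = 0" for X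
  proof -
    have "X \<in> SSP_obstructions A"
      using graph_matrices_cl0_complement_obstruction[OF assms(2)] that by blast
    then show ?thesis
      using assms(6) inner_edge_matrix[of "complement G" X x]
      by (auto simp: complement_def SSP_obstructions_def)
  qed
  then obtain Y K where Y: "Y \<in> graph_matrices_cl G" and K: "K \<in> skew_matrices"
    and BYK: "?B = Y + 2 *\<^sub>R (K ** A - A ** K)"
    using first_order_solvable[OF symA sym_edge_matrix] by blast
  \<comment> \<open>The initial velocity is the commutator part of the decomposition of \<open>?B\<close>; subtracting \<open>Y\<close> changes
    \<open>?B\<close> only on the diagonal and on \<open>G\<close>.\<close>
  define Y0 where "Y0 = ?B - Y"
  have Y0_edge: "Y0 $ i $ j = x {i, j}" if "{i, j} \<in> complement G" for i j
  proof -
    have "i \<noteq> j" "{i, j} \<notin> G"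
      using that by (auto simp: complement_def)
    then show ?thesis
      using Y that by (simp add: Y0_def edge_matrix_def graph_matrices_cl_def)
  qed
  have Y0: "Y0 \<in> graph_matrices_cl ?H"
    unfolding graph_matrices_cl_def
  proof (intro CollectI conjI allI impI)
    show "sym_matrix Y0"
      using Y sym_edge_matrix[of "complement G" x]
      by (simp add: Y0_def graph_matrices_cl_def sym_matrix_def transpose_diff)
    fix i j assume "i \<noteq> j" "{i, j} \<notin> ?H"
    then have ij: "{i, j} \<in> complement G"
      by (simp add: complement_def)
    moreover have "x {i, j} = 0"
      using ij \<open>{i, j} \<notin> ?H\<close> assms(5) by (auto simp: edge_supp_def)
    ultimately show "Y0 $ i $ j = 0"
      using Y0_edge by simp
  qed
  have "Y0 + 2 *\<^sub>R ((- K) ** A - A ** (- K)) = 0"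
    using BYK by (simp add: Y0_def matrix_mult_expand algebra_simps)
  moreover have "- K \<in> skew_matrices"
    using K by (simp add: skew_matrices_def transpose_minus)
  ultimately obtain V where V: "(V \<longlongrightarrow> Y0) (at_right 0)"
    and ev: "\<forall>\<^sub>F t in at_right 0. V t \<in> graph_matrices_cl ?H \<and> charpoly (A + t *\<^sub>R V t) = charpoly A"
    using isospectral_family[OF symA triv Y0] by blast
  define M where "M = (\<lambda>t. A + t *\<^sub>R V t)"
  have M: "(M \<longlongrightarrow> A) (at_right 0)"
    unfolding M_def by (rule tendsto_eq_intros V refl | simp)+
  have ev_SSP: "\<forall>\<^sub>F t in at_right 0. \<forall>X\<in>graph_matrices_cl0 (complement ?H).
      M t ** X - X ** M t = 0 \<longrightarrow> X = 0"
    by (rule trivial_centralizer_eventually[OF subspace_graph_matrices_cl0 triv M])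
  have ev_N: "\<forall>\<^sub>F t in at_right 0. N (M t - A) < \<epsilon>"
  proof -
    have "isCont N 0"
      using continuous_matrix_norm[OF assms(7)] by (simp add: continuous_on_eq_continuous_at)
    moreover have "((\<lambda>t. M t - A) \<longlongrightarrow> 0) (at_right 0)"
      using M by (rule LIM_zero)
    ultimately have "((\<lambda>t. N (M t - A)) \<longlongrightarrow> N 0) (at_right 0)"
      by (rule isCont_tendsto_compose)
    moreover have "N 0 < \<epsilon>"
      using assms(7) \<open>\<epsilon> > 0\<close> unfolding matrix_norm_def by metis
    ultimately show ?thesis
      by (rule order_tendstoD(2))
  qed
  have ev_G: "\<forall>\<^sub>F t in at_right 0. \<forall>i j. i \<noteq> j \<longrightarrow> {i, j} \<in> G \<longrightarrow> sgn (M t $ i $ j) = sgn (A $ i $ j)"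
  proof (intro eventually_all_finite)
    fix i j
    have "\<forall>\<^sub>F t in at_right 0. sgn (M t $ i $ j) = sgn (A $ i $ j)" if "i \<noteq> j" "{i, j} \<in> G"
      using assms(2) that by (intro eventually_sgn_eq tendsto_intros M) (simp add: graph_matrices_def)
    then show "\<forall>\<^sub>F t in at_right 0. i \<noteq> j \<longrightarrow> {i, j} \<in> G \<longrightarrow> sgn (M t $ i $ j) = sgn (A $ i $ j)"
      by (cases "i \<noteq> j \<and> {i, j} \<in> G") auto
  qed
  have ev_\<beta>: "\<forall>\<^sub>F t in at_right 0. \<forall>i j. {i, j} \<in> \<beta> \<longrightarrow> sgn (V t $ i $ j) = sgn (x {i, j})"
  proof (intro eventually_all_finite)
    fix i j
    have "\<forall>\<^sub>F t in at_right 0. sgn (V t $ i $ j) = sgn (x {i, j})" if "{i, j} \<in> \<beta>"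
    proof -
      have "{i, j} \<in> complement G" "x {i, j} \<noteq> 0"
        using that assms(5) by (auto simp: edge_supp_def)
      moreover have "((\<lambda>t. V t $ i $ j) \<longlongrightarrow> Y0 $ i $ j) (at_right 0)"
        by (intro tendsto_intros V)
      ultimately show ?thesis
        using eventually_sgn_eq Y0_edge by metis
    qed
    then show "\<forall>\<^sub>F t in at_right 0. {i, j} \<in> \<beta> \<longrightarrow> sgn (V t $ i $ j) = sgn (x {i, j})"
      by (cases "{i, j} \<in> \<beta>") auto
  qed
  have "\<forall>\<^sub>F t in at_right (0::real). 0 < t"
    by (rule eventually_at_right_less)
  from eventually_happens[OF eventually_conj[OF this eventually_conj[OF ev eventually_conj[OF ev_SSP
      eventually_conj[OF ev_N eventually_conj[OF ev_G ev_\<beta>]]]]]]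
  obtain t where t: "0 < t" and Vt: "V t \<in> graph_matrices_cl ?H"
    and cp: "charpoly (M t) = charpoly A"
    and trivt: "\<And>X. X \<in> graph_matrices_cl0 (complement ?H) \<Longrightarrow> M t ** X - X ** M t = 0 \<Longrightarrow> X = 0"
    and Nt: "N (M t - A) < \<epsilon>"
    and Gt: "\<And>i j. i \<noteq> j \<Longrightarrow> {i, j} \<in> G \<Longrightarrow> sgn (M t $ i $ j) = sgn (A $ i $ j)"
    and \<beta>t: "\<And>i j. {i, j} \<in> \<beta> \<Longrightarrow> sgn (V t $ i $ j) = sgn (x {i, j})"
    by (auto simp: M_def)
  have sgn_\<beta>: "sgn (M t $ i $ j) = sgn (x {i, j})" if "{i, j} \<in> \<beta>" for i j
  proof -
    have "i \<noteq> j" "{i, j} \<notin> G"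
      using that assms(3) by (auto simp: complement_def)
    then have "A $ i $ j = 0"
      using assms(2) unfolding graph_matrices_def by blast
    then show ?thesis
      using \<beta>t[OF that] t by (simp add: M_def sgn_mult)
  qed
  have sgn_off: "sgn (M t $ i $ j) = sgn (A $ i $ j)" if "i \<noteq> j" "{i, j} \<notin> \<beta>" for i j
    using Gt[of i j] that Vt assms(2)
    by (cases "{i, j} \<in> G") (auto simp: M_def graph_matrices_cl_def graph_matrices_def)
  have Mt: "M t \<in> graph_matrices ?H"
    unfolding graph_matrices_def
  proof (intro CollectI conjI allI impI)
    show "sym_matrix (M t)"
      using Vt symA by (simp add: M_def graph_matrices_cl_def sym_matrix_def transpose_expand)
    fix i j :: 'n assume ij: "i \<noteq> j"
    show "M t $ i $ j \<noteq> 0 \<longleftrightarrow> {i, j} \<in> ?H"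
    proof (cases "{i, j} \<in> \<beta>")
      case True
      then have "x {i, j} \<noteq> 0"
        using assms(5) by (auto simp: edge_supp_def)
      then show ?thesis
        using sgn_\<beta>[OF True] True by (metis UnI2 sgn_0_0)
    next
      case False
      then show ?thesis
        using sgn_off[OF ij False] ij assms(2) by (simp add: graph_matrices_def) (metis sgn_0_0)
    qed
  qed
  show "\<exists>A' \<in> graph_matrices ?H. spec A' = spec A \<and> has_SSP A' \<and> N (A' - A) < \<epsilon> \<and>
       (\<forall>i j. {i, j} \<in> \<beta> \<longrightarrow> sgn (A' $ i $ j) = sgn (x {i, j})) \<and>
       (\<forall>i j. i \<noteq> j \<and> {i, j} \<notin> \<beta> \<longrightarrow> sgn (A' $ i $ j) = sgn (A $ i $ j))"
    using Mt cp has_SSP_if_trivial_centralizer[OF Mt trivt] Nt sgn_\<beta> sgn_off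
    by (intro bexI[of _ "M t"]) (auto simp: spec_def)
qed

end
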